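(* Let $S\subseteq\mathbb{Z}_2^n$, let $$\mathcal{D}=\Bigl\{D\subseteq S:\sum_{d\in D}d=0\Bigr\}$$ be the space of dependency relations of $S$, where addition is symmetric difference, and define $q:\mathcal{D}\to\mathbb{Z}_2$ by $q(D)=\binom{|D|}{2}\pmod 2$. Then the following statements are equivalent: (1) $S$ has the $\Theta$-property; (2) $q$ is a linear function on $\mathcal{D}$; (3) for every $D_1,D_2\in\mathcal{D}$, $|D_1\cap D_2|\equiv|D_1|\,|D_2|\pmod 2$. Equivalently (to (3)), two dependency relations have intersection of odd size if and only if both have odd size.
   Context: $\Theta$-property: $S\subseteq\mathbb{Z}_2^n$ has the $\Theta$-property if for any three pairwise disjoint subsets of $S$ whose element sums are equal, at least two of the three subsets have even size. (An empty subset is allowed; its sum is $0$. The set $S$ may contain $0$.) $\mathcal{D}$ is a vector space over $\mathbb{F}_2$ under symmetric difference. *)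

theory Defs
  imports
    "HOL-Library.Z2"
    "HOL-Number_Theory.Cong"
    "Jordan_Normal_Form.VS_Connect"
begin

text \<open>
  The group $\mathbb{Z}_2^n$ is \<^term>\<open>carrier_vec n :: bit vec set\<close>, where \<^typ>\<open>bit\<close> is the
  two-element field. The field as a HOL-Algebra structure is \<^term>\<open>class_ring :: bit ring\<close>.
\<close>

definition elem_sum :: "nat \<Rightarrow> bit vec set \<Rightarrow> bit vec" where
  "elem_sum n A = finsum_vec TYPE(bit) n (\<lambda>d. d) A"

definition theta_property :: "nat \<Rightarrow> bit vec set \<Rightarrow> bool" where
  "theta_property n S \<longleftrightarrow>
     (\<forall>A B C. A \<subseteq> S \<and> B \<subseteq> S \<and> C \<subseteq> S \<and>
        A \<inter> B = {} \<and> A \<inter> C = {} \<and> B \<inter> C = {} \<and>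
        elem_sum n A = elem_sum n B \<and> elem_sum n B = elem_sum n C \<longrightarrow>
          (even (card A) \<and> even (card B)) \<or>
          (even (card A) \<and> even (card C)) \<or>
          (even (card B) \<and> even (card C)))"

definition dependencies :: "nat \<Rightarrow> bit vec set \<Rightarrow> bit vec set set" where
  "dependencies n S = {D. D \<subseteq> S \<and> elem_sum n D = 0\<^sub>v n}"

text \<open>
  HOL-Algebra modules extend the ring record; the fields \<^const>\<open>mult\<close> and \<^const>\<open>one\<close> play no
  role in a vector space and are left \<^const>\<open>undefined\<close>, as in \<^const>\<open>module_vec\<close>.
\<close>

definition dependency_space :: "nat \<Rightarrow> bit vec set \<Rightarrow> (bit, bit vec set) module" where
  "dependency_space n S = \<lparr>
     carrier = dependencies n S,
     mult = undefined,
     one = undefined,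
     zero = {},
     add = sym_diff,
     smult = (\<lambda>c D. if c = 0 then {} else D)\<rparr>"

definition scalar_space :: "(bit, bit) module" where
  "scalar_space = \<lparr>
     carrier = UNIV,
     mult = undefined,
     one = undefined,
     zero = 0,
     add = (+),
     smult = (*)\<rparr>"

definition q_form :: "bit vec set \<Rightarrow> bit" where
  "q_form D = of_nat (card D choose 2)"


lemma cring_bit: "cring (class_ring :: bit ring)"
  using class_field by (rule fieldE(1))

text \<open>The two structures above are vector spaces over the two-element field.\<close>

lemma finite_carrier_vec_bit: "finite (carrier_vec n :: bit vec set)"
proof -
  have "finite (UNIV :: bit set)"
    by (rule finite_subset[of _ "{0, 1}"]) auto
  then have "finite {xs :: bit list. set xs \<subseteq> UNIV \<and> length xs = n}"
    by (rule finite_lists_length_eq)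
  moreover have "(carrier_vec n :: bit vec set) \<subseteq>
      vec_of_list ` {xs. set xs \<subseteq> UNIV \<and> length xs = n}"
  proof
    fix v :: "bit vec"
    assume "v \<in> carrier_vec n"
    then show "v \<in> vec_of_list ` {xs. set xs \<subseteq> UNIV \<and> length xs = n}"
      by (intro image_eqI[of _ _ "list_of_vec v"]) (auto simp: vec_list)
  qed
  ultimately show ?thesis
    using finite_surj by blast
qed

lemma elem_sum_carrier:
  assumes "A \<subseteq> carrier_vec n"
  shows "elem_sum n A \<in> carrier_vec n"
  unfolding elem_sum_def using assms by (intro finsum_vec_closed) auto

lemma index_elem_sum:
  assumes "A \<subseteq> carrier_vec n" and "i < n"
  shows "elem_sum n A $ i = (\<Sum>d\<in>A. d $ i)"
  unfolding elem_sum_def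
  by (rule index_finsum_vec)
    (use assms finite_subset[OF _ finite_carrier_vec_bit] in auto)

lemma elem_sum_eq_zero_iff:
  assumes "A \<subseteq> carrier_vec n"
  shows "elem_sum n A = 0\<^sub>v n \<longleftrightarrow> (\<forall>i<n. (\<Sum>d\<in>A. d $ i) = 0)"
proof -
  have "elem_sum n A = 0\<^sub>v n \<longleftrightarrow> (\<forall>i<n. elem_sum n A $ i = 0)"
    using elem_sum_carrier[OF assms] by (auto intro!: eq_vecI)
  then show ?thesis
    using index_elem_sum[OF assms] by auto
qed

lemma sum_sym_diff_bit:
  fixes f :: "'a \<Rightarrow> bit"
  assumes "finite A" and "finite B"
  shows "sum f (sym_diff A B) = sum f A + sum f B"
proof -
  have A: "sum f A = sum f (A - B) + sum f (A \<inter> B)"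
    using assms by (subst sum.union_disjoint[symmetric]) (auto intro: sum.cong)
  have B: "sum f B = sum f (B - A) + sum f (A \<inter> B)"
    using assms by (subst sum.union_disjoint[symmetric]) (auto intro: sum.cong)
  have "sum f (sym_diff A B) = sum f (A - B) + sum f (B - A)"
    using assms by (subst sum.union_disjoint) auto
  moreover have "x + z + (y + z) = x + y" for x y z :: bit
    by (cases z) (auto simp: ac_simps)
  ultimately show ?thesis
    by (simp only: A B)
qed

lemma sym_diff_dependencies:
  assumes "S \<subseteq> carrier_vec n" "D \<in> dependencies n S" "E \<in> dependencies n S"
  shows "sym_diff D E \<in> dependencies n S"
proof -
  have sub: "D \<subseteq> carrier_vec n" "E \<subseteq> carrier_vec n" "sym_diff D E \<subseteq> carrier_vec n"
    and S: "sym_diff D E \<subseteq> S"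
    using assms by (auto simp: dependencies_def)
  have fin: "finite D" "finite E"
    using sub finite_subset[OF _ finite_carrier_vec_bit] by blast+
  have "\<forall>i<n. (\<Sum>d\<in>sym_diff D E. d $ i) = 0"
    using assms(2,3) unfolding dependencies_def
    by (simp add: sum_sym_diff_bit[OF fin] elem_sum_eq_zero_iff[OF sub(1)]
        elem_sum_eq_zero_iff[OF sub(2)])
  then show ?thesis
    using S elem_sum_eq_zero_iff[OF sub(3)] by (simp add: dependencies_def)
qed

lemma empty_dependencies: "{} \<in> dependencies n S"
  by (simp add: dependencies_def elem_sum_def finsum_vec_empty)

lemma vectorspace_dependency_space:
  assumes "S \<subseteq> carrier_vec n"
  shows "vectorspace class_ring (dependency_space n S)"
proof -
  have "Module.module class_ring (dependency_space n S)"
  proof (rule Module.moduleI[OF cring_bit])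
    show "abelian_group (dependency_space n S)"
    proof (rule abelian_groupI)
      fix D assume "D \<in> carrier (dependency_space n S)"
      then show "\<exists>E\<in>carrier (dependency_space n S).
          E \<oplus>\<^bsub>dependency_space n S\<^esub> D = \<zero>\<^bsub>dependency_space n S\<^esub>"
        by (intro bexI[of _ D]) (auto simp: dependency_space_def)
    qed (use sym_diff_dependencies[OF assms] empty_dependencies in
        \<open>auto simp: dependency_space_def\<close>)
  qed (auto simp: dependency_space_def empty_dependencies)
  then show ?thesis
    using class_field[where 'a = bit] by (simp only: vectorspace_def simp_thms)
qed

lemma vectorspace_scalar_space: "vectorspace class_ring scalar_space"
proof -
  have "Module.module class_ring scalar_space"
  proof (rule Module.moduleI[OF cring_bit])
    show "abelian_group scalar_space"
      by (rule abelian_groupI) (auto simp: scalar_space_def ac_simps intro: exI[of _ "- _"])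
  qed (auto simp: scalar_space_def algebra_simps)
  then show ?thesis
    using class_field[where 'a = bit] by (simp only: vectorspace_def simp_thms)
qed

end

theory Submission
  imports Defs
begin

text \<open>
  Two dependency relations \<open>D\<close> and \<open>E\<close> correspond to three pairwise disjoint sets with a
  common element sum, namely \<open>D - E\<close>, \<open>E - D\<close> and \<open>D \<inter> E\<close>. If \<open>a\<close>, \<open>b\<close>, \<open>c\<close> are the sizes of
  these sets, then each of the conditions says that \<open>a * b + a * c + b * c\<close> is even; for the
  additivity of \<open>q\<close> this uses
  $\binom{x + y}{2} = \binom{x}{2} + \binom{y}{2} + x y$.
\<close>

lemma of_nat_bit_eq_iff: "(of_nat x :: bit) = of_nat y \<longleftrightarrow> (even x \<longleftrightarrow> even y)"
  by (cases "of_nat x :: bit"; cases "of_nat y :: bit")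
    (use even_of_nat[where 'a = bit] in force)+

lemma cong_mod_2_nat_iff: "[x = y] (mod 2) \<longleftrightarrow> (even x \<longleftrightarrow> even y)" for x y :: nat
  by (auto simp: cong_def even_iff_mod_2_eq_zero)

lemma choose_two_add: "(x + y) choose 2 = (x choose 2) + (y choose 2) + x * y"
  by (induction y) (simp_all add: numeral_2_eq_2)

text \<open>If at most one of the numbers is odd, every product is even; if two or three are odd,
  then one or three of the products are odd. The right-hand side has the shape of the conclusion in
  \<open>theta_property\<close>.\<close>

lemma even_pairwise_products_iff:
  fixes a b c :: nat
  shows "even (a * b + a * c + b * c) \<longleftrightarrow>
    (even a \<and> even b) \<or> (even a \<and> even c) \<or> (even b \<and> even c)"
  by auto

text \<open>With \<open>a\<close>, \<open>b\<close>, \<open>c\<close> the sizes of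
  \<open>D - E\<close>, \<open>E - D\<close>, \<open>D \<inter> E\<close>, this is additivity of
  \<open>q_form\<close> at \<open>D\<close>, \<open>E\<close>. After expansion
  \<open>a choose 2\<close> and \<open>b choose 2\<close> cancel, \<open>c choose 2\<close> occurs
  twice, and only the mixed products remain modulo 2.\<close>

lemma q_form_add_parity_iff:
  fixes a b c :: nat
  shows "(of_nat ((a + b) choose 2) :: bit) =
      of_nat ((a + c) choose 2) + of_nat ((b + c) choose 2)
    \<longleftrightarrow> even (a * b + a * c + b * c)"
  unfolding of_nat_add[symmetric] of_nat_bit_eq_iff choose_two_add by auto

lemma finite_subset_carrier_vec_bit: "finite A" if "A \<subseteq> carrier_vec n" for A :: "bit vec set"
  using that finite_carrier_vec_bit by (rule finite_subset)

text \<open>On the right, elements of \<open>A \<inter> B\<close> are counted twice and cancel in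
  characteristic 2; this is checked coordinatewise.\<close>

lemma elem_sum_sym_diff:
  assumes "A \<subseteq> carrier_vec n" "B \<subseteq> carrier_vec n"
  shows "elem_sum n (sym_diff A B) = elem_sum n A + elem_sum n B"
proof (rule eq_vecI)
  have sub: "sym_diff A B \<subseteq> carrier_vec n"
    using assms by auto
  show "dim_vec (elem_sum n (sym_diff A B)) = dim_vec (elem_sum n A + elem_sum n B)"
    using elem_sum_carrier[OF sub] elem_sum_carrier[OF assms(2)] by simp
  fix i assume "i < dim_vec (elem_sum n A + elem_sum n B)"
  then have "i < n"
    using elem_sum_carrier[OF assms(2)] by simp
  then show "elem_sum n (sym_diff A B) $ i = (elem_sum n A + elem_sum n B) $ i"
    using elem_sum_carrier[OF assms(2)]
      sum_sym_diff_bit[OF assms[THEN finite_subset_carrier_vec_bit], of "\<lambda>d. d $ i"]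
    by (simp add: index_elem_sum[OF sub] index_elem_sum[OF assms(1)] index_elem_sum[OF assms(2)])
qed

lemma add_bit_vec_eq_zero_iff:
  fixes u v :: "bit vec"
  assumes "u \<in> carrier_vec n" "v \<in> carrier_vec n"
  shows "u + v = 0\<^sub>v n \<longleftrightarrow> u = v"
proof -
  have "x + y = 0 \<longleftrightarrow> x = y" for x y :: bit
    by (cases x; cases y) auto
  then show ?thesis
    using assms by (auto simp: vec_eq_iff)
qed

text \<open>Translates between dependency relations and pairs of sets with a common sum: every
  vector over \<open>bit\<close> is its own negative.\<close>

lemma elem_sum_sym_diff_eq_zero_iff:
  assumes "A \<subseteq> carrier_vec n" "B \<subseteq> carrier_vec n"
  shows "elem_sum n (sym_diff A B) = 0\<^sub>v n \<longleftrightarrow> elem_sum n A = elem_sum n B"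
  using assms by (simp add: elem_sum_sym_diff add_bit_vec_eq_zero_iff elem_sum_carrier)

lemma theta_property_iff_dependencies:
  assumes S: "S \<subseteq> carrier_vec n"
  shows "theta_property n S \<longleftrightarrow>
    (\<forall>D\<in>dependencies n S. \<forall>E\<in>dependencies n S.
       even (card (D - E) * card (E - D) + card (D - E) * card (D \<inter> E)
         + card (E - D) * card (D \<inter> E)))"
proof (intro iffI ballI)
  fix D E
  assume theta: "theta_property n S" and "D \<in> dependencies n S" "E \<in> dependencies n S"
  then have sub: "D \<subseteq> S" "E \<subseteq> S" and sum: "elem_sum n D = 0\<^sub>v n" "elem_sum n E = 0\<^sub>v n"
    by (auto simp: dependencies_def)
  \<comment> \<open>Splitting \<open>D\<close> and \<open>E\<close> along their intersection turns
    each vanishing sum into an equality with the sum of \<open>D \<inter> E\<close>.\<close>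
  have eq: "sym_diff (D - E) (D \<inter> E) = D" "sym_diff (E - D) (D \<inter> E) = E"
    by auto
  have "D - E \<subseteq> carrier_vec n" "E - D \<subseteq> carrier_vec n" "D \<inter> E \<subseteq> carrier_vec n"
    using sub S by auto
  then have "elem_sum n (D - E) = elem_sum n (D \<inter> E)" "elem_sum n (E - D) = elem_sum n (D \<inter> E)"
    using sum by (simp_all only: elem_sum_sym_diff_eq_zero_iff[symmetric] eq)
  moreover have "D - E \<subseteq> S" "E - D \<subseteq> S" "D \<inter> E \<subseteq> S"
      "(D - E) \<inter> (E - D) = {}" "(D - E) \<inter> (D \<inter> E) = {}" "(E - D) \<inter> (D \<inter> E) = {}"
    using sub by auto
  ultimately show "even (card (D - E) * card (E - D) + card (D - E) * card (D \<inter> E)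
      + card (E - D) * card (D \<inter> E))"
    using theta[unfolded theta_property_def, rule_format, of "D - E" "E - D" "D \<inter> E"]
    unfolding even_pairwise_products_iff by metis
next
  assume deps: "\<forall>D\<in>dependencies n S. \<forall>E\<in>dependencies n S.
    even (card (D - E) * card (E - D) + card (D - E) * card (D \<inter> E)
      + card (E - D) * card (D \<inter> E))"
  show "theta_property n S"
    unfolding theta_property_def
  proof (intro allI impI, elim conjE)
    fix A B C
    assume sub: "A \<subseteq> S" "B \<subseteq> S" "C \<subseteq> S"
      and disj: "A \<inter> B = {}" "A \<inter> C = {}" "B \<inter> C = {}"
      and sum: "elem_sum n A = elem_sum n B" "elem_sum n B = elem_sum n C"
    have "A \<subseteq> carrier_vec n" "B \<subseteq> carrier_vec n" "C \<subseteq> carrier_vec n"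
      using sub S by auto
    then have "elem_sum n (sym_diff A C) = 0\<^sub>v n" "elem_sum n (sym_diff B C) = 0\<^sub>v n"
      using sum by (simp_all only: elem_sum_sym_diff_eq_zero_iff)
    moreover have "sym_diff A C = A \<union> C" "sym_diff B C = B \<union> C"
      using disj by auto
    \<comment> \<open>These two dependencies share exactly \<open>C\<close>, so their differences
      and intersection give back \<open>A\<close>, \<open>B\<close> and \<open>C\<close>.\<close>
    ultimately have "A \<union> C \<in> dependencies n S" "B \<union> C \<in> dependencies n S"
      using sub by (simp_all add: dependencies_def)
    moreover have "(A \<union> C) - (B \<union> C) = A" "(B \<union> C) - (A \<union> C) = B" "(A \<union> C) \<inter> (B \<union> C) = C"
      using disj by auto
    ultimately show "(even (card A) \<and> even (card B)) \<or> (even (card A) \<and> even (card C)) \<or>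
        (even (card B) \<and> even (card C))"
      using deps unfolding even_pairwise_products_iff by metis
  qed
qed

text \<open>The only scalars are 0 and 1, so homogeneity reduces to \<open>q_form {} = 0\<close>,
  which holds because \<open>0 choose 2 = 0\<close>. Only additivity remains.\<close>

lemma linear_map_q_form_iff:
  assumes "S \<subseteq> carrier_vec n"
  shows "linear_map class_ring (dependency_space n S) scalar_space q_form \<longleftrightarrow>
    (\<forall>D\<in>dependencies n S. \<forall>E\<in>dependencies n S.
       q_form (sym_diff D E) = q_form D + q_form E)"
proof -
  have q_smult: "q_form (if c = 0 then {} else D) = c * q_form D" for c :: bit and D
    by (cases c) (simp_all add: q_form_def numeral_2_eq_2)
  have "linear_map class_ring (dependency_space n S) scalar_space q_form \<longleftrightarrow>
      q_form \<in> LinearCombinations.module_hom class_ring (dependency_space n S) scalar_space"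
    using vectorspace_dependency_space[OF assms] vectorspace_scalar_space
    by (auto simp: linear_map_def mod_hom_def mod_hom_axioms_def vectorspace_def)
  then show ?thesis
    by (auto simp: LinearCombinations.module_hom_def dependency_space_def scalar_space_def q_smult)
qed

lemma card_by_differences:
  assumes "finite D" "finite E"
  shows "card D = card (D - E) + card (D \<inter> E)"
    and "card E = card (E - D) + card (D \<inter> E)"
    and "card (sym_diff D E) = card (D - E) + card (E - D)"
  using assms
  by (simp_all add: card_Diff_subset_Int card_mono card_Un_disjoint Int_commute Diff_Int_distrib)

theorem lemma5p3:
  fixes n :: nat and S :: "bit vec set"
  assumes "S \<subseteq> carrier_vec n"
  shows "(theta_property n S \<longleftrightarrow>
            linear_map class_ring (dependency_space n S) scalar_space q_form)
       \<and> (linear_map class_ring (dependency_space n S) scalar_space q_form \<longleftrightarrow>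
            (\<forall>D1\<in>dependencies n S. \<forall>D2\<in>dependencies n S.
               [card (D1 \<inter> D2) = card D1 * card D2] (mod 2)))
       \<and> ((\<forall>D1\<in>dependencies n S. \<forall>D2\<in>dependencies n S.
               [card (D1 \<inter> D2) = card D1 * card D2] (mod 2)) \<longleftrightarrow>
            (\<forall>D1\<in>dependencies n S. \<forall>D2\<in>dependencies n S.
               odd (card (D1 \<inter> D2)) \<longleftrightarrow> odd (card D1) \<and> odd (card D2)))"
proof -
  let ?even = "\<lambda>D E :: bit vec set. even (card (D - E) * card (E - D)
    + card (D - E) * card (D \<inter> E) + card (E - D) * card (D \<inter> E))"
  have fin: "finite D" if "D \<in> dependencies n S" for D
    using that assms finite_subset_carrier_vec_bit[of D n] by (auto simp: dependencies_def)
  have q: "q_form (sym_diff D E) = q_form D + q_form E \<longleftrightarrow> ?even D E"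
    if "D \<in> dependencies n S" "E \<in> dependencies n S" for D E
    unfolding q_form_def card_by_differences[OF fin[OF that(1)] fin[OF that(2)]]
    by (rule q_form_add_parity_iff)
  \<comment> \<open>For the sizes \<open>a\<close>, \<open>b\<close>, \<open>c\<close> as above,
    \<open>(a + c) * (b + c)\<close> equals \<open>a * b + a * c + b * c + c * c\<close>, and
    \<open>c * c\<close> has the parity of \<open>c\<close>.\<close>
  have inter: "[card (D \<inter> E) = card D * card E] (mod 2) \<longleftrightarrow> ?even D E"
    if "D \<in> dependencies n S" "E \<in> dependencies n S" for D E
    unfolding cong_mod_2_nat_iff card_by_differences(1,2)[OF fin[OF that(1)] fin[OF that(2)]]
    by auto
  have "linear_map class_ring (dependency_space n S) scalar_space q_form \<longleftrightarrow>
      (\<forall>D\<in>dependencies n S. \<forall>E\<in>dependencies n S. ?even D E)"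
    unfolding linear_map_q_form_iff[OF assms] using q by simp
  moreover have "(\<forall>D\<in>dependencies n S. \<forall>E\<in>dependencies n S.
        [card (D \<inter> E) = card D * card E] (mod 2)) \<longleftrightarrow>
      (\<forall>D\<in>dependencies n S. \<forall>E\<in>dependencies n S. ?even D E)"
    using inter by simp
  moreover have "[card (D \<inter> E) = card D * card E] (mod 2) \<longleftrightarrow>
      (odd (card (D \<inter> E)) \<longleftrightarrow> odd (card D) \<and> odd (card E))" for D E :: "bit vec set"
    unfolding cong_mod_2_nat_iff by auto
  ultimately show ?thesis
    using theta_property_iff_dependencies[OF assms] by simp
qed

end
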